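(* Let $\mathcal A=\langle A;\Xi\rangle$ be an algebra and let $f\colon A\to A$ be a mapping. 1) The following two conditions are equivalent: (i) $f$ is stable preorder preserving (i.e. $f$ preserves every $\mathcal A$-stable preorder on $A$); (ii) for every subset $L\subseteq A$, $f^{-1}(L)$ belongs to the complete lattice $\mathfrak L^\infty_{\mathcal A}(L)$. 2) The following two conditions are equivalent: (i') $f$ preserves every $\mathcal A$-stable preorder which has finite index; (ii') for every $\mathcal A$-recognizable subset $L\subseteq A$, $f^{-1}(L)$ belongs to the bounded lattice $\mathfrak L_{\mathcal A}(L)$.
   Context: An algebra $\mathcal A=\langle A;\Xi\rangle$ is a nonempty set $A$ with a set $\Xi$ of operations $\xi\colon A^{ar(\xi)}\to A$ of finite arities. A preorder is a reflexive transitive relation. A binary relation $\rho$ on $A$ is compatible with $g\colon A^p\to A$ if $x_1\rho y_1,\dots,x_p\rho y_p$ imply $g(x_1,\dots,x_p)\,\rho\,g(y_1,\dots,y_p)$; it is $\mathcal A$-stable if it is compatible with every $\xi\in\Xi$. An $\mathcal A$-congruence is an $\mathcal A$-stable equivalence relation. A function $f\colon A\to A$ preserves $\rho$ if $\rho$ is compatible with $f$. A congruence has finite index if it has finitely many classes; a stable preorder $\preceq$ has finite index if the congruence $x\sim y\Leftrightarrow(x\preceq y\wedge y\preceq x)$ has finite index. A subset $L\subseteq A$ is $\mathcal A$-recognizable if there are a finite algebra $\mathcal M$ with the same signature as $\mathcal A$ and a surjective morphism $\varphi\colon\mathcal A\to\mathcal M$ such that $L=\varphi^{-1}(\varphi(L))$.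 The 1-freezifications of an operation $\xi$ of arity $n$ are $\xi$ itself if $n=1$, and, if $n\ge2$, all unary functions $x\mapsto\xi(c_1,\dots,c_{i-1},x,c_{i+1},\dots,c_n)$ with $1\le i\le n$ and $c_j\in A$. $\mathrm{Frz}^*(\mathcal A)$ is the set of unary functions on $A$ consisting of the identity and all compositions of 1-freezifications of operations in $\Xi$. A (bounded) lattice of subsets of $A$ is a family of subsets containing $A$ and $\emptyset$ and closed under binary unions and intersections; it is complete if closed under arbitrary unions and intersections. $\mathfrak L_{\mathcal A}(L)$ (resp. $\mathfrak L^\infty_{\mathcal A}(L)$) is the smallest bounded lattice (resp. complete lattice) of subsets of $A$ which contains $L$ and is closed under $X\mapsto\gamma^{-1}(X)$ for all $\gamma\in\mathrm{Frz}^*(\mathcal A)$. *)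

theory Defs
  imports "HOL-Algebra.Congruence"
begin

section \<open>Algebras\<close>

text \<open>The signature of an algebra is its set of operation symbols (possibly empty) together with
  their arities; constants (arity 0) are allowed. A tuple is a list of the appropriate length.
  The values of \<^term>\<open>arity\<close> and \<^term>\<open>interp\<close> elsewhere than on operation symbols and on tuples
  of the right length over the carrier are irrelevant.\<close>

record ('i, 'a) univ_algebra = "'a partial_object" +
  symbols :: "'i set"
  arity :: "'i \<Rightarrow> nat"
  interp :: "'i \<Rightarrow> 'a list \<Rightarrow> 'a"

definition tuples :: "'a set \<Rightarrow> nat \<Rightarrow> 'a list set" where
  "tuples A n = {xs. length xs = n \<and> set xs \<subseteq> A}"

definition is_algebra :: "('i, 'a) univ_algebra \<Rightarrow> bool" where
  "is_algebra \<A> \<longleftrightarrow> carrier \<A> \<noteq> {} \<and>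
     (\<forall>\<xi>\<in>symbols \<A>. interp \<A> \<xi> \<in> tuples (carrier \<A>) (arity \<A> \<xi>) \<rightarrow> carrier \<A>)"

definition same_signature :: "('i, 'a) univ_algebra \<Rightarrow> ('i, 'b) univ_algebra \<Rightarrow> bool" where
  "same_signature \<A> \<M> \<longleftrightarrow> symbols \<A> = symbols \<M> \<and> (\<forall>\<xi>\<in>symbols \<A>. arity \<A> \<xi> = arity \<M> \<xi>)"

definition morphism :: "('i, 'a) univ_algebra \<Rightarrow> ('i, 'b) univ_algebra \<Rightarrow> ('a \<Rightarrow> 'b) \<Rightarrow> bool" where
  "morphism \<A> \<M> \<phi> \<longleftrightarrow> \<phi> \<in> carrier \<A> \<rightarrow> carrier \<M> \<and>
     (\<forall>\<xi>\<in>symbols \<A>. \<forall>xs\<in>tuples (carrier \<A>) (arity \<A> \<xi>).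
        \<phi> (interp \<A> \<xi> xs) = interp \<M> \<xi> (map \<phi> xs))"


section \<open>Stable preorders\<close>

definition compatible :: "'a set \<Rightarrow> nat \<Rightarrow> ('a list \<Rightarrow> 'a) \<Rightarrow> 'a rel \<Rightarrow> bool" where
  "compatible A p g \<rho> \<longleftrightarrow>
     (\<forall>xs\<in>tuples A p. \<forall>ys\<in>tuples A p. list_all2 (\<lambda>x y. (x, y) \<in> \<rho>) xs ys \<longrightarrow> (g xs, g ys) \<in> \<rho>)"

definition stable :: "('i, 'a) univ_algebra \<Rightarrow> 'a rel \<Rightarrow> bool" where
  "stable \<A> \<rho> \<longleftrightarrow> (\<forall>\<xi>\<in>symbols \<A>. compatible (carrier \<A>) (arity \<A> \<xi>) (interp \<A> \<xi>) \<rho>)"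

definition preserves :: "'a set \<Rightarrow> ('a \<Rightarrow> 'a) \<Rightarrow> 'a rel \<Rightarrow> bool" where
  "preserves A f \<rho> \<longleftrightarrow> (\<forall>x\<in>A. \<forall>y\<in>A. (x, y) \<in> \<rho> \<longrightarrow> (f x, f y) \<in> \<rho>)"

lemma preserves_iff_compatible: "preserves A f \<rho> \<longleftrightarrow> compatible A 1 (\<lambda>xs. f (hd xs)) \<rho>"
proof -
  have "tuples A 1 = (\<lambda>x. [x]) ` A"
    by (auto simp: tuples_def length_Suc_conv)
  then show ?thesis
    by (auto simp: preserves_def compatible_def)
qed

definition stable_preorder :: "('i, 'a) univ_algebra \<Rightarrow> 'a rel \<Rightarrow> bool" where
  "stable_preorder \<A> \<rho> \<longleftrightarrow> preorder_on (carrier \<A>) \<rho> \<and> stable \<A> \<rho>"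

definition congruence :: "('i, 'a) univ_algebra \<Rightarrow> 'a rel \<Rightarrow> bool" where
  "congruence \<A> \<theta> \<longleftrightarrow> equiv (carrier \<A>) \<theta> \<and> stable \<A> \<theta>"

definition congruence_finite_index :: "('i, 'a) univ_algebra \<Rightarrow> 'a rel \<Rightarrow> bool" where
  "congruence_finite_index \<A> \<theta> \<longleftrightarrow> finite (carrier \<A> // \<theta>)"

definition preorder_congruence :: "'a rel \<Rightarrow> 'a rel" where
  "preorder_congruence \<rho> = {(x, y). (x, y) \<in> \<rho> \<and> (y, x) \<in> \<rho>}"

lemma congruence_preorder_congruence:
  assumes "stable_preorder \<A> \<rho>"
  shows "congruence \<A> (preorder_congruence \<rho>)"
proof -
  have "equiv (carrier \<A>) (preorder_congruence \<rho>)"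
    using assms
    unfolding stable_preorder_def preorder_on_def preorder_congruence_def equiv_def
      refl_on_def sym_def trans_def by blast
  moreover have "stable \<A> (preorder_congruence \<rho>)"
    using assms
    unfolding stable_preorder_def stable_def compatible_def preorder_congruence_def
    by (auto simp: list_all2_conv_all_nth)
  ultimately show ?thesis
    by (simp add: congruence_def)
qed

definition preorder_finite_index :: "('i, 'a) univ_algebra \<Rightarrow> 'a rel \<Rightarrow> bool" where
  "preorder_finite_index \<A> \<rho> \<longleftrightarrow> congruence_finite_index \<A> (preorder_congruence \<rho>)"


section \<open>Recognizable sets\<close>

definition recognizes ::
    "('i, 'a) univ_algebra \<Rightarrow> ('i, 'b) univ_algebra \<Rightarrow> ('a \<Rightarrow> 'b) \<Rightarrow> 'a set \<Rightarrow> bool" where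
  "recognizes \<A> \<M> \<phi> L \<longleftrightarrow>
     is_algebra \<M> \<and> finite (carrier \<M>) \<and> same_signature \<A> \<M> \<and>
     morphism \<A> \<M> \<phi> \<and> \<phi> ` carrier \<A> = carrier \<M> \<and>
     L = \<phi> -` (\<phi> ` L) \<inter> carrier \<A>"

text \<open>One cannot quantify over the type of the elements of the finite algebra inside a definition,
  so its carrier is taken to be a finite set of natural numbers. Lemma \<open>recognizable_if_recognizes\<close>
  shows that this is no restriction.\<close>

definition recognizable :: "('i, 'a) univ_algebra \<Rightarrow> 'a set \<Rightarrow> bool" where
  "recognizable \<A> L \<longleftrightarrow> L \<subseteq> carrier \<A> \<and>
     (\<exists>(\<M> :: ('i, nat) univ_algebra) \<phi>. recognizes \<A> \<M> \<phi> L)"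

lemma recognizable_if_recognizes:
  fixes \<M> :: "('i, 'b) univ_algebra"
  assumes L: "L \<subseteq> carrier \<A>" and rec: "recognizes \<A> \<M> \<phi> L"
  shows "recognizable \<A> L"
proof -
  let ?M = "carrier \<M>"
  obtain h :: "'b \<Rightarrow> nat" where h: "inj_on h ?M"
    using rec finite_imp_inj_to_nat_seg unfolding recognizes_def by metis
  define k where "k = inv_into ?M h"
  have kh: "k (h x) = x" if "x \<in> ?M" for x
    using h that by (simp add: k_def)
  define \<N> :: "('i, nat) univ_algebra" where
    "\<N> = \<lparr>carrier = h ` ?M, symbols = symbols \<M>, arity = arity \<M>,
          interp = (\<lambda>\<xi> xs. h (interp \<M> \<xi> (map k xs)))\<rparr>"
  have k_tuples: "map k xs \<in> tuples ?M n" if "xs \<in> tuples (h ` ?M) n" for xs n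
    using that kh by (auto simp: tuples_def)
  have \<phi>: "\<phi> x \<in> ?M" if "x \<in> carrier \<A>" for x
    using rec that by (auto simp: recognizes_def)
  have "is_algebra \<N>"
    using rec k_tuples by (force simp: recognizes_def is_algebra_def \<N>_def)
  moreover have "finite (carrier \<N>)" "same_signature \<A> \<N>"
    using rec by (auto simp: recognizes_def \<N>_def same_signature_def)
  moreover have "morphism \<A> \<N> (h \<circ> \<phi>)"
  proof -
    have "map k (map (h \<circ> \<phi>) xs) = map \<phi> xs" if "xs \<in> tuples (carrier \<A>) n" for xs n
      using that kh \<phi> by (auto simp: tuples_def)
    then show ?thesis
      using rec \<phi> by (auto simp: recognizes_def morphism_def \<N>_def simp del: map_map)
  qed
  moreover have "(h \<circ> \<phi>) ` carrier \<A> = carrier \<N>"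
    using rec unfolding recognizes_def \<N>_def by (metis image_comp partial_object.select_convs(1))
  moreover have "L = (h \<circ> \<phi>) -` ((h \<circ> \<phi>) ` L) \<inter> carrier \<A>"
  proof -
    have "h (\<phi> x) \<in> (h \<circ> \<phi>) ` L \<longleftrightarrow> \<phi> x \<in> \<phi> ` L" if "x \<in> carrier \<A>" for x
      using L \<phi> that inj_onD[OF h] by (auto simp: image_iff) (metis subsetD)
    then have "(h \<circ> \<phi>) -` ((h \<circ> \<phi>) ` L) \<inter> carrier \<A> = \<phi> -` (\<phi> ` L) \<inter> carrier \<A>"
      by (simp add: vimage_def set_eq_iff del: image_iff) (metis comp_apply)
    then show ?thesis
      using rec by (simp add: recognizes_def)
  qed
  ultimately have "recognizes \<A> \<N> (h \<circ> \<phi>) L"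
    by (simp add: recognizes_def)
  then show ?thesis
    using L by (auto simp: recognizable_def)
qed


section \<open>Freezifications\<close>

text \<open>In the second rule the variable has index \<open>length cs + 1\<close> and the frozen arguments are
  \<open>cs\<close> and \<open>ds\<close>.\<close>

inductive_set freezifications1 :: "('i, 'a) univ_algebra \<Rightarrow> ('a \<Rightarrow> 'a) set" for \<A> where
  unary: "\<lbrakk>\<xi> \<in> symbols \<A>; arity \<A> \<xi> = 1\<rbrakk> \<Longrightarrow> (\<lambda>x. interp \<A> \<xi> [x]) \<in> freezifications1 \<A>"
| frozen: "\<lbrakk>\<xi> \<in> symbols \<A>; arity \<A> \<xi> \<ge> 2; length cs + 1 + length ds = arity \<A> \<xi>;
     set cs \<subseteq> carrier \<A>; set ds \<subseteq> carrier \<A>\<rbrakk>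
   \<Longrightarrow> (\<lambda>x. interp \<A> \<xi> (cs @ x # ds)) \<in> freezifications1 \<A>"

inductive_set Frz :: "('i, 'a) univ_algebra \<Rightarrow> ('a \<Rightarrow> 'a) set" for \<A> where
  id: "id \<in> Frz \<A>"
| comp: "\<lbrakk>\<gamma> \<in> freezifications1 \<A>; \<delta> \<in> Frz \<A>\<rbrakk> \<Longrightarrow> \<gamma> \<circ> \<delta> \<in> Frz \<A>"


section \<open>Lattices of subsets\<close>

definition subset_lattice :: "'a set \<Rightarrow> 'a set set \<Rightarrow> bool" where
  "subset_lattice A \<F> \<longleftrightarrow> \<F> \<subseteq> Pow A \<and> A \<in> \<F> \<and> {} \<in> \<F> \<and>
     (\<forall>X\<in>\<F>. \<forall>Y\<in>\<F>. X \<union> Y \<in> \<F> \<and> X \<inter> Y \<in> \<F>)"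

text \<open>The intersection with \<open>A\<close> makes the intersection of the empty family equal to \<open>A\<close>.\<close>

definition complete_subset_lattice :: "'a set \<Rightarrow> 'a set set \<Rightarrow> bool" where
  "complete_subset_lattice A \<F> \<longleftrightarrow> subset_lattice A \<F> \<and>
     (\<forall>\<G>. \<G> \<subseteq> \<F> \<longrightarrow> \<Union>\<G> \<in> \<F> \<and> A \<inter> \<Inter>\<G> \<in> \<F>)"

definition closed_under_Frz_preimages :: "('i, 'a) univ_algebra \<Rightarrow> 'a set set \<Rightarrow> bool" where
  "closed_under_Frz_preimages \<A> \<F> \<longleftrightarrow> (\<forall>\<gamma>\<in>Frz \<A>. \<forall>X\<in>\<F>. \<gamma> -` X \<inter> carrier \<A> \<in> \<F>)"

definition generated_lattice :: "('i, 'a) univ_algebra \<Rightarrow> 'a set \<Rightarrow> 'a set set" where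
  "generated_lattice \<A> L =
     \<Inter>{\<F>. subset_lattice (carrier \<A>) \<F> \<and> L \<in> \<F> \<and> closed_under_Frz_preimages \<A> \<F>}"

definition generated_complete_lattice :: "('i, 'a) univ_algebra \<Rightarrow> 'a set \<Rightarrow> 'a set set" where
  "generated_complete_lattice \<A> L =
     \<Inter>{\<F>. complete_subset_lattice (carrier \<A>) \<F> \<and> L \<in> \<F> \<and> closed_under_Frz_preimages \<A> \<F>}"

end

theory Submission
  imports Defs
begin

text \<open>
  Both equivalences rest on a dictionary between preorders and families of sets: a preorder is
  determined by its up-sets (the sets that contain, with each \<open>x\<close>, everything above \<open>x\<close>).

  A preorder is stable as soon as every 1-freezification preserves it, because the arguments of an
  operation can be exchanged one at a time, transitivity linking the successive steps
  (\<open>stable_if_freezifications1_preserve\<close>). Hence the up-sets of a stable preorder \<open>\<rho>\<close> form a complete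
  lattice closed under preimages by \<open>\<gamma> \<in> Frz \<A>\<close>, and whenever \<open>L\<close> is an up-set of \<open>\<rho>\<close>, so is every
  member of the two lattices generated by \<open>L\<close> (\<open>generated_complete_lattice_up_sets\<close>,
  \<open>generated_lattice_up_sets\<close>). Applied to the principal up-set \<open>L = {z. f x \<rho> z}\<close>, this gives the
  implications from the lattice conditions to preservation: \<open>f\<^sup>-\<^sup>1 L\<close> is an up-set containing \<open>x\<close>, so
  \<open>x \<rho> y\<close> implies \<open>f x \<rho> f y\<close>. If \<open>\<rho>\<close> has finite index, then this \<open>L\<close> is recognizable, the quotient
  by the congruence of \<open>\<rho>\<close> being the finite algebra required
  (\<open>recognizable_if_saturated\<close>).

  Conversely, every \<open>L\<close> has a syntactic preorder: \<open>x\<close> is below \<open>y\<close> if \<open>\<gamma> x \<in> L\<close> implies \<open>\<gamma> y \<in> L\<close>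
  for all \<open>\<gamma> \<in> Frz \<A>\<close>. It is stable, and \<open>L\<close> is one of its up-sets, so \<open>f\<^sup>-\<^sup>1 L\<close> is an up-set too if \<open>f\<close>
  preserves the preorder. An up-set of this preorder is the union, over its points \<open>x\<close>, of the intersections
  of all the \<open>\<gamma>\<^sup>-\<^sup>1 L\<close> that contain \<open>x\<close>, and so lies in the complete lattice generated by \<open>L\<close>. If \<open>L\<close> is
  recognizable, then only finitely many sets \<open>\<gamma>\<^sup>-\<^sup>1 L\<close> exist (\<open>finite_Frz_preimages\<close>); this makes the
  syntactic preorder of finite index and the unions and intersections finite.
\<close>

section \<open>Freezifications and stability\<close>

lemma freezifications1_closed:
  assumes "is_algebra \<A>" "\<gamma> \<in> freezifications1 \<A>" "x \<in> carrier \<A>"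
  shows "\<gamma> x \<in> carrier \<A>"
  using assms(2,1,3) by cases (auto simp: is_algebra_def tuples_def Pi_iff)

lemma Frz_closed:
  assumes "is_algebra \<A>" "\<gamma> \<in> Frz \<A>" "x \<in> carrier \<A>"
  shows "\<gamma> x \<in> carrier \<A>"
  using assms(2,3) by induction (auto intro: freezifications1_closed[OF assms(1)])

lemma Frz_comp_freezification1:
  assumes "\<delta> \<in> Frz \<A>" "\<gamma> \<in> freezifications1 \<A>"
  shows "\<delta> \<circ> \<gamma> \<in> Frz \<A>"
  using assms(1)
proof induction
  case id
  show ?case using Frz.comp[OF assms(2) Frz.id] by simp
next
  case (comp \<gamma>' \<delta>)
  then show ?case using Frz.comp[of \<gamma>' \<A> "\<delta> \<circ> \<gamma>"] by (simp only: comp_assoc)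
qed

lemma freezifications1_preserve_if_stable:
  assumes "stable \<A> \<rho>" "refl_on (carrier \<A>) \<rho>" "\<gamma> \<in> freezifications1 \<A>"
  shows "preserves (carrier \<A>) \<gamma> \<rho>"
  using assms(3)
proof cases
  case (unary \<xi>)
  show ?thesis
    unfolding preserves_def
  proof (intro ballI impI)
    fix x y assume "x \<in> carrier \<A>" "y \<in> carrier \<A>" "(x, y) \<in> \<rho>"
    then have "[x] \<in> tuples (carrier \<A>) 1" "[y] \<in> tuples (carrier \<A>) 1"
      "list_all2 (\<lambda>x y. (x, y) \<in> \<rho>) [x] [y]" by (auto simp: tuples_def)
    then show "(\<gamma> x, \<gamma> y) \<in> \<rho>"
      using assms(1) unary unfolding stable_def compatible_def by auto
  qed
next
  case (frozen \<xi> cs ds)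
  have refl: "list_all2 (\<lambda>x y. (x, y) \<in> \<rho>) zs zs" if "set zs \<subseteq> carrier \<A>" for zs
    using that assms(2) by (auto simp: list_all2_same dest: refl_onD)
  show ?thesis
    unfolding preserves_def
  proof (intro ballI impI)
    fix x y assume "x \<in> carrier \<A>" "y \<in> carrier \<A>" "(x, y) \<in> \<rho>"
    then have "cs @ x # ds \<in> tuples (carrier \<A>) (arity \<A> \<xi>)"
      "cs @ y # ds \<in> tuples (carrier \<A>) (arity \<A> \<xi>)"
      "list_all2 (\<lambda>x y. (x, y) \<in> \<rho>) (cs @ x # ds) (cs @ y # ds)"
      using frozen refl by (auto simp: tuples_def intro!: list_all2_appendI)
    then show "(\<gamma> x, \<gamma> y) \<in> \<rho>"
      using assms(1) frozen unfolding stable_def compatible_def by auto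
  qed
qed

lemma Frz_preserve_if_stable:
  assumes "is_algebra \<A>" "stable \<A> \<rho>" "refl_on (carrier \<A>) \<rho>" "\<gamma> \<in> Frz \<A>"
  shows "preserves (carrier \<A>) \<gamma> \<rho>"
  using assms(4)
proof induction
  case id
  show ?case by (simp add: preserves_def)
next
  case (comp \<gamma> \<delta>)
  then show ?case
    using freezifications1_preserve_if_stable[OF assms(2,3)] Frz_closed[OF assms(1)]
    by (simp add: preserves_def)
qed

text \<open>The arguments are exchanged from left to right: \<open>cs\<close> holds those already exchanged, and each
  step freezes all the others, so that it is the action of a single 1-freezification. Reflexivity
  starts the chain, and by itself settles the constants, which have no 1-freezification.\<close>

lemma stable_if_freezifications1_preserve:
  assumes A: "is_algebra \<A>" and refl: "refl_on (carrier \<A>) \<rho>" and trans: "trans \<rho>"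
    and pres: "\<And>\<gamma>. \<gamma> \<in> freezifications1 \<A> \<Longrightarrow> preserves (carrier \<A>) \<gamma> \<rho>"
  shows "stable \<A> \<rho>"
proof -
  have exchange: "(interp \<A> \<xi> (cs @ xs), interp \<A> \<xi> (cs @ ys)) \<in> \<rho>"
    if "\<xi> \<in> symbols \<A>" and "list_all2 (\<lambda>x y. (x, y) \<in> \<rho>) xs ys"
      and "length cs + length xs = arity \<A> \<xi>" "set cs \<subseteq> carrier \<A>"
      and "set xs \<subseteq> carrier \<A>" "set ys \<subseteq> carrier \<A>"
    for \<xi> cs xs ys
    using that(2-)
  proof (induction arbitrary: cs rule: list_all2_induct)
    case Nil
    then have "interp \<A> \<xi> cs \<in> carrier \<A>"
      using A that(1) by (auto simp: is_algebra_def tuples_def)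
    then show ?case using refl by (auto dest: refl_onD)
  next
    case (Cons x xs y ys)
    have "(\<lambda>z. interp \<A> \<xi> (cs @ z # xs)) \<in> freezifications1 \<A>"
    proof (cases "arity \<A> \<xi> = 1")
      case True
      with Cons.prems have "cs = []" "xs = []" by auto
      with True that(1) show ?thesis by (simp add: freezifications1.unary)
    next
      case False
      with Cons.prems that(1) show ?thesis by (intro freezifications1.frozen) auto
    qed
    then have "(interp \<A> \<xi> (cs @ x # xs), interp \<A> \<xi> (cs @ y # xs)) \<in> \<rho>"
      using pres Cons.prems Cons.hyps unfolding preserves_def by fastforce
    moreover have "(interp \<A> \<xi> ((cs @ [y]) @ xs), interp \<A> \<xi> ((cs @ [y]) @ ys)) \<in> \<rho>"
      using Cons.prems by (intro Cons.IH) auto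
    ultimately show ?case
      using trans by (auto dest: transD)
  qed
  show ?thesis
    unfolding stable_def compatible_def
    using exchange[where cs = "[]"] by (auto simp: tuples_def)
qed

section \<open>Up-sets of stable preorders\<close>

definition up_sets :: "'a set \<Rightarrow> 'a rel \<Rightarrow> 'a set set" where
  "up_sets A \<rho> = {U. U \<subseteq> A \<and> (\<forall>x\<in>U. \<forall>y\<in>A. (x, y) \<in> \<rho> \<longrightarrow> y \<in> U)}"

lemma complete_subset_lattice_up_sets: "complete_subset_lattice A (up_sets A \<rho>)"
  unfolding complete_subset_lattice_def subset_lattice_def
proof (intro conjI allI impI)
  fix \<G> assume "\<G> \<subseteq> up_sets A \<rho>"
  then show "\<Union>\<G> \<in> up_sets A \<rho>" "A \<inter> \<Inter>\<G> \<in> up_sets A \<rho>"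
    unfolding up_sets_def by blast+
qed (auto simp: up_sets_def)

lemma up_sets_closed_under_Frz_preimages:
  assumes "is_algebra \<A>" "stable_preorder \<A> \<rho>"
  shows "closed_under_Frz_preimages \<A> (up_sets (carrier \<A>) \<rho>)"
  unfolding closed_under_Frz_preimages_def
proof (intro ballI)
  fix \<gamma> X assume "\<gamma> \<in> Frz \<A>" "X \<in> up_sets (carrier \<A>) \<rho>"
  moreover from this have "preserves (carrier \<A>) \<gamma> \<rho>"
    using assms by (intro Frz_preserve_if_stable) (auto simp: stable_preorder_def preorder_on_def)
  ultimately show "\<gamma> -` X \<inter> carrier \<A> \<in> up_sets (carrier \<A>) \<rho>"
    using Frz_closed[OF assms(1)] unfolding up_sets_def preserves_def by auto
qed

lemma generated_complete_lattice_up_sets: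
  assumes "is_algebra \<A>" "stable_preorder \<A> \<rho>" "L \<in> up_sets (carrier \<A>) \<rho>"
  shows "generated_complete_lattice \<A> L \<subseteq> up_sets (carrier \<A>) \<rho>"
  unfolding generated_complete_lattice_def
  using assms complete_subset_lattice_up_sets up_sets_closed_under_Frz_preimages
  by (intro Inter_lower) auto

lemma generated_lattice_up_sets:
  assumes "is_algebra \<A>" "stable_preorder \<A> \<rho>" "L \<in> up_sets (carrier \<A>) \<rho>"
  shows "generated_lattice \<A> L \<subseteq> up_sets (carrier \<A>) \<rho>"
  unfolding generated_lattice_def
  using assms complete_subset_lattice_up_sets up_sets_closed_under_Frz_preimages
  by (intro Inter_lower) (auto simp: complete_subset_lattice_def)

lemma principal_up_set:
  assumes "trans \<rho>"
  shows "{z \<in> A. (x, z) \<in> \<rho>} \<in> up_sets A \<rho>"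
  using assms by (auto simp: up_sets_def dest: transD)

text \<open>A function whose preimage of each principal up-set at a point \<open>f x\<close> is an up-set preserves
  the preorder, since by reflexivity that preimage contains \<open>x\<close>.\<close>

lemma preserves_if_preimages_up_sets:
  assumes "refl_on A \<rho>" "f \<in> A \<rightarrow> A"
    and "\<And>x. x \<in> A \<Longrightarrow> f -` {z \<in> A. (f x, z) \<in> \<rho>} \<inter> A \<in> up_sets A \<rho>"
  shows "preserves A f \<rho>"
  unfolding preserves_def
proof (intro ballI impI)
  fix x y assume xy: "x \<in> A" "y \<in> A" "(x, y) \<in> \<rho>"
  then have "x \<in> f -` {z \<in> A. (f x, z) \<in> \<rho>} \<inter> A"
    using assms(1,2) by (auto dest: refl_onD)
  with assms(3)[OF xy(1)] xy have "y \<in> f -` {z \<in> A. (f x, z) \<in> \<rho>} \<inter> A"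
    unfolding up_sets_def by blast
  then show "(f x, f y) \<in> \<rho>" by simp
qed

section \<open>Recognizability of saturated sets\<close>

text \<open>The recognizing algebra is the quotient by \<open>\<theta>\<close>. Its operations choose representatives of the
  classes; stability makes the class of the result independent of that choice, whence the canonical
  map is a morphism.\<close>

lemma recognizable_if_saturated:
  fixes \<A> :: "('i, 'a) univ_algebra"
  assumes A: "is_algebra \<A>" and \<theta>: "congruence \<A> \<theta>" "congruence_finite_index \<A> \<theta>"
    and L: "L \<subseteq> carrier \<A>" and sat: "\<And>x y. x \<in> L \<Longrightarrow> (x, y) \<in> \<theta> \<Longrightarrow> y \<in> L"
  shows "recognizable \<A> L"
proof -
  let ?A = "carrier \<A>"
  define \<phi> where "\<phi> x = \<theta> `` {x}" for x
  define rep where "rep X = (SOME x. x \<in> X)" for X :: "'a set"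
  define \<M> :: "('i, 'a set) univ_algebra" where
    "\<M> = \<lparr>carrier = ?A // \<theta>, symbols = symbols \<A>, arity = arity \<A>,
          interp = (\<lambda>\<xi> Xs. \<phi> (interp \<A> \<xi> (map rep Xs)))\<rparr>"
  have equiv: "equiv ?A \<theta>"
    using \<theta>(1) by (simp add: congruence_def)
  have rep_in: "rep X \<in> X" if "X \<in> ?A // \<theta>" for X
    using in_quotient_imp_non_empty[OF equiv that] by (auto simp: rep_def some_in_eq)
  have rep_carrier: "rep X \<in> ?A" if "X \<in> ?A // \<theta>" for X
    using rep_in[OF that] in_quotient_imp_subset[OF equiv that] by auto
  have \<phi>_in: "\<phi> x \<in> ?A // \<theta>" if "x \<in> ?A" for x
    using that by (simp add: \<phi>_def quotientI)
  have rep_related: "(x, rep (\<phi> x)) \<in> \<theta>" if "x \<in> ?A" for x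
    using rep_in[OF \<phi>_in[OF that]] by (simp add: \<phi>_def)
  have "is_algebra \<M>"
    unfolding is_algebra_def
  proof (intro conjI ballI funcsetI)
    show "carrier \<M> \<noteq> {}"
      using A by (simp add: \<M>_def is_algebra_def)
    fix \<xi> Xs assume *: "\<xi> \<in> symbols \<M>" "Xs \<in> tuples (carrier \<M>) (arity \<M> \<xi>)"
    then have "map rep Xs \<in> tuples ?A (arity \<A> \<xi>)"
      using rep_carrier by (auto simp: \<M>_def tuples_def)
    then have "interp \<A> \<xi> (map rep Xs) \<in> ?A"
      using A * unfolding is_algebra_def \<M>_def by auto
    then show "interp \<M> \<xi> Xs \<in> carrier \<M>"
      using \<phi>_in by (simp add: \<M>_def)
  qed
  moreover have "morphism \<A> \<M> \<phi>"
    unfolding morphism_def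
  proof (intro conjI ballI)
    show "\<phi> \<in> ?A \<rightarrow> carrier \<M>"
      using \<phi>_in by (simp add: \<M>_def)
    fix \<xi> xs assume *: "\<xi> \<in> symbols \<A>" "xs \<in> tuples ?A (arity \<A> \<xi>)"
    have "map rep (map \<phi> xs) \<in> tuples ?A (arity \<A> \<xi>)"
      using * \<phi>_in rep_carrier by (auto simp: tuples_def)
    moreover have "list_all2 (\<lambda>x y. (x, y) \<in> \<theta>) xs (map rep (map \<phi> xs))"
      using * rep_related
      by (auto simp: tuples_def list_all2_conv_all_nth subset_iff)
    ultimately have "(interp \<A> \<xi> xs, interp \<A> \<xi> (map rep (map \<phi> xs))) \<in> \<theta>"
      using * \<theta>(1) unfolding congruence_def stable_def compatible_def by blast
    then show "\<phi> (interp \<A> \<xi> xs) = interp \<M> \<xi> (map \<phi> xs)"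
      using equiv_class_eq[OF equiv] by (simp add: \<phi>_def \<M>_def)
  qed
  moreover have "\<phi> ` ?A = carrier \<M>"
    by (auto simp: \<phi>_def \<M>_def quotient_def)
  moreover have "L = \<phi> -` (\<phi> ` L) \<inter> ?A"
  proof -
    have "x \<in> L" if "x \<in> ?A" "y \<in> L" "\<phi> x = \<phi> y" for x y
      using that sat eq_equiv_class[of \<theta> y x ?A] equiv by (auto simp: \<phi>_def)
    then show ?thesis
      using L by auto
  qed
  moreover have "finite (carrier \<M>)" "same_signature \<A> \<M>"
    using \<theta>(2) by (simp_all add: \<M>_def same_signature_def congruence_finite_index_def)
  ultimately have "recognizes \<A> \<M> \<phi> L"
    unfolding recognizes_def by iprover
  then show ?thesis
    using L by (intro recognizable_if_recognizes)
qed

section \<open>The syntactic preorder\<close>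

definition syntactic_preorder :: "('i, 'a) univ_algebra \<Rightarrow> 'a set \<Rightarrow> 'a rel" where
  "syntactic_preorder \<A> L =
     {(x, y). x \<in> carrier \<A> \<and> y \<in> carrier \<A> \<and> (\<forall>\<gamma>\<in>Frz \<A>. \<gamma> x \<in> L \<longrightarrow> \<gamma> y \<in> L)}"

definition Frz_preimages :: "('i, 'a) univ_algebra \<Rightarrow> 'a set \<Rightarrow> 'a set set" where
  "Frz_preimages \<A> L = (\<lambda>\<gamma>. \<gamma> -` L \<inter> carrier \<A>) ` Frz \<A>"

lemma syntactic_preorder_iff_Frz_preimages:
  assumes "x \<in> carrier \<A>" "y \<in> carrier \<A>"
  shows "(x, y) \<in> syntactic_preorder \<A> L \<longleftrightarrow> (\<forall>P\<in>Frz_preimages \<A> L. x \<in> P \<longrightarrow> y \<in> P)"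
  using assms by (auto simp: syntactic_preorder_def Frz_preimages_def)

lemma stable_preorder_syntactic_preorder:
  assumes "is_algebra \<A>"
  shows "stable_preorder \<A> (syntactic_preorder \<A> L)"
proof -
  let ?\<rho> = "syntactic_preorder \<A> L"
  have pre: "preorder_on (carrier \<A>) ?\<rho>"
    unfolding preorder_on_def refl_on_def trans_def syntactic_preorder_def by auto
  \<comment> \<open>If \<open>\<gamma>\<close> is a 1-freezification, the tests on \<open>\<gamma> x\<close> are among those on \<open>x\<close>: \<open>\<delta> (\<gamma> x) = (\<delta> \<circ> \<gamma>) x\<close>.\<close>
  moreover have "stable \<A> ?\<rho>"
  proof (rule stable_if_freezifications1_preserve[OF assms])
    fix \<gamma> assume \<gamma>: "\<gamma> \<in> freezifications1 \<A>"
    have "(\<gamma> x, \<gamma> y) \<in> ?\<rho>" if xy: "x \<in> carrier \<A>" "y \<in> carrier \<A>" "(x, y) \<in> ?\<rho>" for x y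
    proof -
      have "\<delta> (\<gamma> y) \<in> L" if "\<delta> \<in> Frz \<A>" "\<delta> (\<gamma> x) \<in> L" for \<delta>
        using xy that Frz_comp_freezification1[OF that(1) \<gamma>]
        by (auto simp: syntactic_preorder_def)
      then show ?thesis
        using xy freezifications1_closed[OF assms \<gamma>] by (simp add: syntactic_preorder_def)
    qed
    then show "preserves (carrier \<A>) \<gamma> ?\<rho>"
      by (simp add: preserves_def)
  qed (use pre in \<open>auto simp: preorder_on_def\<close>)
  ultimately show ?thesis by (simp add: stable_preorder_def)
qed

text \<open>The identity belongs to \<open>Frz \<A>\<close>, so \<open>L\<close> itself is an up-set.\<close>

lemma preimage_up_set_if_preserves_syntactic_preorder:
  assumes "preserves (carrier \<A>) f (syntactic_preorder \<A> L)"
  shows "f -` L \<inter> carrier \<A> \<in> up_sets (carrier \<A>) (syntactic_preorder \<A> L)"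
proof -
  have "f y \<in> L" if "x \<in> carrier \<A>" "y \<in> carrier \<A>" "(x, y) \<in> syntactic_preorder \<A> L" "f x \<in> L"
    for x y
  proof -
    have "(f x, f y) \<in> syntactic_preorder \<A> L"
      using assms that by (auto simp: preserves_def)
    then show ?thesis
      using that(4) Frz.id[of \<A>] by (auto simp: syntactic_preorder_def)
  qed
  then show ?thesis by (auto simp: up_sets_def)
qed

text \<open>The smallest up-set containing a point is the intersection of the Frz-preimages of \<open>L\<close> that
  contain it.\<close>

lemma up_set_eq_Union_Inter_Frz_preimages:
  assumes "U \<in> up_sets (carrier \<A>) (syntactic_preorder \<A> L)"
  shows "U = \<Union>((\<lambda>x. carrier \<A> \<inter> \<Inter>{P \<in> Frz_preimages \<A> L. x \<in> P}) ` U)"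
proof -
  have "y \<in> U" if "x \<in> U" "y \<in> carrier \<A>" "\<forall>P\<in>Frz_preimages \<A> L. x \<in> P \<longrightarrow> y \<in> P" for x y
    using assms that syntactic_preorder_iff_Frz_preimages[of x \<A> y L]
    unfolding up_sets_def by blast
  moreover have "U \<subseteq> carrier \<A>"
    using assms by (simp add: up_sets_def)
  ultimately show ?thesis by blast
qed

lemma Frz_preimages_subset:
  assumes "closed_under_Frz_preimages \<A> \<F>" "L \<in> \<F>"
  shows "Frz_preimages \<A> L \<subseteq> \<F>"
  using assms by (auto simp: Frz_preimages_def closed_under_Frz_preimages_def)

lemma up_set_in_generated_complete_lattice:
  assumes "U \<in> up_sets (carrier \<A>) (syntactic_preorder \<A> L)"
  shows "U \<in> generated_complete_lattice \<A> L"
  unfolding generated_complete_lattice_def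
proof (intro InterI, clarify)
  fix \<F> assume lat: "complete_subset_lattice (carrier \<A>) \<F>"
    and \<F>: "L \<in> \<F>" "closed_under_Frz_preimages \<A> \<F>"
  have "carrier \<A> \<inter> \<Inter>{P \<in> Frz_preimages \<A> L. x \<in> P} \<in> \<F>" for x
  proof -
    have "{P \<in> Frz_preimages \<A> L. x \<in> P} \<subseteq> \<F>"
      using Frz_preimages_subset[OF \<F>(2,1)] by blast
    then show ?thesis
      using lat unfolding complete_subset_lattice_def by blast
  qed
  then have "\<Union>((\<lambda>x. carrier \<A> \<inter> \<Inter>{P \<in> Frz_preimages \<A> L. x \<in> P}) ` U) \<in> \<F>"
    using lat unfolding complete_subset_lattice_def by (meson image_subsetI)
  then show "U \<in> \<F>"
    using up_set_eq_Union_Inter_Frz_preimages[OF assms] by simp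
qed

section \<open>Finiteness for recognizable sets\<close>

lemma subset_lattice_finite_Union:
  assumes "subset_lattice A \<F>" "finite \<G>" "\<G> \<subseteq> \<F>"
  shows "\<Union>\<G> \<in> \<F>"
  using assms(2,3) by induction (use assms(1) in \<open>auto simp: subset_lattice_def\<close>)

lemma subset_lattice_finite_Inter:
  assumes "subset_lattice A \<F>" "finite \<G>" "\<G> \<subseteq> \<F>"
  shows "A \<inter> \<Inter>\<G> \<in> \<F>"
  using assms(2,3)
proof induction
  case (insert X \<G>)
  then have "X \<inter> (A \<inter> \<Inter>\<G>) \<in> \<F>"
    using assms(1) by (auto simp: subset_lattice_def)
  then show ?case by (simp add: Int_left_commute)
qed (use assms(1) in \<open>auto simp: subset_lattice_def\<close>)

lemma up_set_in_generated_lattice: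
  assumes "U \<in> up_sets (carrier \<A>) (syntactic_preorder \<A> L)" and fin: "finite (Frz_preimages \<A> L)"
  shows "U \<in> generated_lattice \<A> L"
  unfolding generated_lattice_def
proof (intro InterI, clarify)
  fix \<F> assume lat: "subset_lattice (carrier \<A>) \<F>"
    and \<F>: "L \<in> \<F>" "closed_under_Frz_preimages \<A> \<F>"
  let ?N = "\<lambda>x. carrier \<A> \<inter> \<Inter>{P \<in> Frz_preimages \<A> L. x \<in> P}"
  have "?N x \<in> \<F>" for x
    using Frz_preimages_subset[OF \<F>(2,1)] fin by (intro subset_lattice_finite_Inter[OF lat]) auto
  moreover have "finite (?N ` U)"
  proof (rule finite_subset)
    show "?N ` U \<subseteq> (\<lambda>\<P>. carrier \<A> \<inter> \<Inter>\<P>) ` Pow (Frz_preimages \<A> L)" by auto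
  qed (use fin in simp)
  ultimately have "\<Union>(?N ` U) \<in> \<F>"
    by (intro subset_lattice_finite_Union[OF lat]) auto
  then show "U \<in> \<F>"
    using up_set_eq_Union_Inter_Frz_preimages[OF assms(1)] by simp
qed

text \<open>A class of the associated congruence is determined by the Frz-preimages of \<open>L\<close> that contain
  any of its points.\<close>

lemma finite_index_syntactic_preorder:
  assumes "finite (Frz_preimages \<A> L)"
  shows "preorder_finite_index \<A> (syntactic_preorder \<A> L)"
proof -
  let ?\<theta> = "preorder_congruence (syntactic_preorder \<A> L)"
  let ?sig = "\<lambda>x. {P \<in> Frz_preimages \<A> L. x \<in> P}"
  have "?\<theta> `` {x} = {y \<in> carrier \<A>. ?sig y = ?sig x}" if "x \<in> carrier \<A>" for x
  proof -
    have "y \<in> carrier \<A>" if "(x, y) \<in> ?\<theta>" for y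
      using that by (auto simp: preorder_congruence_def syntactic_preorder_def)
    moreover have "(x, y) \<in> ?\<theta> \<longleftrightarrow> ?sig y = ?sig x" if "y \<in> carrier \<A>" for y
      using \<open>x \<in> carrier \<A>\<close> that
      by (auto simp: preorder_congruence_def syntactic_preorder_iff_Frz_preimages)
    ultimately show ?thesis by blast
  qed
  then have "carrier \<A> // ?\<theta>
      \<subseteq> (\<lambda>\<P>. {y \<in> carrier \<A>. ?sig y = \<P>}) ` Pow (Frz_preimages \<A> L)"
    by (auto simp: quotient_def)
  then have "finite (carrier \<A> // ?\<theta>)"
    by (rule finite_subset) (use assms in simp)
  then show ?thesis
    by (simp add: preorder_finite_index_def congruence_finite_index_def)
qed

text \<open>The kernel of a recognizing morphism is a congruence, so each \<open>\<gamma> \<in> Frz \<A>\<close> acts on its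
  classes and \<open>\<gamma>\<^sup>-\<^sup>1 L\<close> is, like \<open>L\<close>, the preimage of a subset of the finite algebra.\<close>

lemma finite_Frz_preimages:
  fixes \<A> :: "('i, 'a) univ_algebra"
  assumes A: "is_algebra \<A>" and L: "recognizable \<A> L"
  shows "finite (Frz_preimages \<A> L)"
proof -
  let ?A = "carrier \<A>"
  obtain \<M> :: "('i, nat) univ_algebra" and \<phi> where rec: "recognizes \<A> \<M> \<phi> L"
    using L by (auto simp: recognizable_def)
  then have fin: "finite (carrier \<M>)" and morph: "morphism \<A> \<M> \<phi>"
    and L_sat: "L = \<phi> -` (\<phi> ` L) \<inter> ?A"
    unfolding recognizes_def by iprover+
  define \<kappa> where "\<kappa> = {(x, y). x \<in> ?A \<and> y \<in> ?A \<and> \<phi> x = \<phi> y}"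
  have "stable \<A> \<kappa>"
    unfolding stable_def compatible_def
  proof (intro ballI impI)
    fix \<xi> xs ys
    assume *: "\<xi> \<in> symbols \<A>" "xs \<in> tuples ?A (arity \<A> \<xi>)" "ys \<in> tuples ?A (arity \<A> \<xi>)"
      "list_all2 (\<lambda>x y. (x, y) \<in> \<kappa>) xs ys"
    have "map \<phi> xs = map \<phi> ys"
      using *(4) by (auto simp: \<kappa>_def list_all2_conv_all_nth intro: nth_equalityI)
    then have "\<phi> (interp \<A> \<xi> xs) = \<phi> (interp \<A> \<xi> ys)"
      using morph * by (simp add: morphism_def)
    then show "(interp \<A> \<xi> xs, interp \<A> \<xi> ys) \<in> \<kappa>"
      using A * by (auto simp: \<kappa>_def is_algebra_def)
  qed
  moreover have "refl_on ?A \<kappa>"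
    by (auto simp: \<kappa>_def refl_on_def)
  ultimately have \<kappa>: "preserves ?A \<gamma> \<kappa>" if "\<gamma> \<in> Frz \<A>" for \<gamma>
    using Frz_preserve_if_stable[OF A] that by blast
  have "\<gamma> -` L \<inter> ?A = \<phi> -` (\<phi> ` (\<gamma> -` L \<inter> ?A)) \<inter> ?A" if \<gamma>: "\<gamma> \<in> Frz \<A>" for \<gamma>
  proof -
    have "\<gamma> x \<in> L" if "x \<in> ?A" "y \<in> ?A" "\<phi> x = \<phi> y" "\<gamma> y \<in> L" for x y
    proof -
      have "(x, y) \<in> \<kappa>"
        using that by (simp add: \<kappa>_def)
      then have "(\<gamma> x, \<gamma> y) \<in> \<kappa>"
        using \<kappa>[OF \<gamma>] that(1,2) by (simp add: preserves_def)
      then have "\<gamma> x \<in> \<phi> -` (\<phi> ` L) \<inter> ?A"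
        using that(4) by (simp add: \<kappa>_def)
      then show ?thesis
        by (simp only: L_sat[symmetric])
    qed
    then show ?thesis by auto
  qed
  moreover have "\<phi> ` (\<gamma> -` L \<inter> ?A) \<in> Pow (carrier \<M>)" for \<gamma>
    using morph by (auto simp: morphism_def)
  ultimately have "Frz_preimages \<A> L \<subseteq> (\<lambda>T. \<phi> -` T \<inter> ?A) ` Pow (carrier \<M>)"
    unfolding Frz_preimages_def by (intro image_subsetI) (rule image_eqI)
  then show ?thesis
    by (rule finite_subset) (use fin in simp)
qed

section \<open>Preorder preservation and lattices of subsets\<close>

theorem theorem3p3:
  fixes \<A> :: "('i, 'a) univ_algebra" and f :: "'a \<Rightarrow> 'a"
  assumes "is_algebra \<A>" and "f \<in> carrier \<A> \<rightarrow> carrier \<A>"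
  shows "((\<forall>\<rho>. stable_preorder \<A> \<rho> \<longrightarrow> preserves (carrier \<A>) f \<rho>) \<longleftrightarrow>
          (\<forall>L. L \<subseteq> carrier \<A> \<longrightarrow>
             f -` L \<inter> carrier \<A> \<in> generated_complete_lattice \<A> L)) \<and>
         ((\<forall>\<rho>. stable_preorder \<A> \<rho> \<and> preorder_finite_index \<A> \<rho> \<longrightarrow> preserves (carrier \<A>) f \<rho>) \<longleftrightarrow>
          (\<forall>L. recognizable \<A> L \<longrightarrow>
             f -` L \<inter> carrier \<A> \<in> generated_lattice \<A> L))"
proof (intro conjI iffI allI impI; (elim conjE)?)
  fix L
  assume "\<forall>\<rho>. stable_preorder \<A> \<rho> \<longrightarrow> preserves (carrier \<A>) f \<rho>"
  then have "preserves (carrier \<A>) f (syntactic_preorder \<A> L)"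
    using stable_preorder_syntactic_preorder[OF assms(1)] by simp
  then show "f -` L \<inter> carrier \<A> \<in> generated_complete_lattice \<A> L"
    by (intro up_set_in_generated_complete_lattice preimage_up_set_if_preserves_syntactic_preorder)
next
  fix \<rho>
  assume lat: "\<forall>L. L \<subseteq> carrier \<A> \<longrightarrow> f -` L \<inter> carrier \<A> \<in> generated_complete_lattice \<A> L"
    and \<rho>: "stable_preorder \<A> \<rho>"
  from \<rho> have refl: "refl_on (carrier \<A>) \<rho>" and trans: "trans \<rho>"
    by (auto simp: stable_preorder_def preorder_on_def)
  show "preserves (carrier \<A>) f \<rho>"
  proof (rule preserves_if_preimages_up_sets[OF refl assms(2)])
    fix x
    let ?L = "{z \<in> carrier \<A>. (f x, z) \<in> \<rho>}"
    have "f -` ?L \<inter> carrier \<A> \<in> generated_complete_lattice \<A> ?L"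
      by (rule lat[rule_format]) auto
    then show "f -` ?L \<inter> carrier \<A> \<in> up_sets (carrier \<A>) \<rho>"
      by (rule subsetD[OF generated_complete_lattice_up_sets
            [OF assms(1) \<rho> principal_up_set[OF trans]]])
  qed
next
  fix L
  assume "\<forall>\<rho>. stable_preorder \<A> \<rho> \<and> preorder_finite_index \<A> \<rho> \<longrightarrow> preserves (carrier \<A>) f \<rho>"
    and "recognizable \<A> L"
  moreover from this have fin: "finite (Frz_preimages \<A> L)"
    using finite_Frz_preimages[OF assms(1)] by blast
  ultimately have "preserves (carrier \<A>) f (syntactic_preorder \<A> L)"
    using stable_preorder_syntactic_preorder[OF assms(1)] finite_index_syntactic_preorder[OF fin]
    by auto
  then show "f -` L \<inter> carrier \<A> \<in> generated_lattice \<A> L"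
    by (intro up_set_in_generated_lattice preimage_up_set_if_preserves_syntactic_preorder fin)
next
  fix \<rho>
  assume lat: "\<forall>L. recognizable \<A> L \<longrightarrow> f -` L \<inter> carrier \<A> \<in> generated_lattice \<A> L"
    and \<rho>: "stable_preorder \<A> \<rho>" and fin: "preorder_finite_index \<A> \<rho>"
  from \<rho> have refl: "refl_on (carrier \<A>) \<rho>" and trans: "trans \<rho>"
    and sub: "\<rho> \<subseteq> carrier \<A> \<times> carrier \<A>"
    by (auto simp: stable_preorder_def preorder_on_def)
  show "preserves (carrier \<A>) f \<rho>"
  proof (rule preserves_if_preimages_up_sets[OF refl assms(2)])
    fix x
    let ?L = "{z \<in> carrier \<A>. (f x, z) \<in> \<rho>}"
    have "recognizable \<A> ?L"
    proof (rule recognizable_if_saturated[OF assms(1) congruence_preorder_congruence[OF \<rho>]])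
      show "congruence_finite_index \<A> (preorder_congruence \<rho>)"
        using fin by (simp add: preorder_finite_index_def)
      show "z \<in> ?L" if "y \<in> ?L" "(y, z) \<in> preorder_congruence \<rho>" for y z
        using that sub trans by (auto simp: preorder_congruence_def dest: transD)
    qed auto
    then have "f -` ?L \<inter> carrier \<A> \<in> generated_lattice \<A> ?L"
      by (rule lat[rule_format])
    then show "f -` ?L \<inter> carrier \<A> \<in> up_sets (carrier \<A>) \<rho>"
      by (rule subsetD[OF generated_lattice_up_sets[OF assms(1) \<rho> principal_up_set[OF trans]]])
  qed
qed

end
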